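(* Let $\Phi=(G,\varphi)$ be a connected $\mathbb{T}$-gain graph on $n$ vertices with maximum vertex degree $\Delta\geq 3$, and let $r(\Phi)$ be the rank of its adjacency matrix $A(\Phi)$. Then the inequality $$r(\Phi)\geq\frac{n}{\Delta-1}$$ holds if and only if $\Phi$ is not switching equivalent to $(K_{\frac n2,\frac n2},1)$ (for $n$ even) and not switching equivalent to $(K_{\frac{n+1}{2},\frac{n-1}{2}},1)$ (for $n$ odd).
   Context: Let $\mathbb{T}=\{z\in\mathbb{C}:|z|=1\}$. Let $G$ be a finite simple undirected graph with vertices $v_1,\dots,v_n$. For each edge $e_{s,t}$ joining $v_s$ and $v_t$ there are two oriented edges $\overrightarrow{e_{s,t}}$ (from $v_s$ to $v_t$) and $\overrightarrow{e_{t,s}}$. A $\mathbb{T}$-gain graph (complex unit gain graph) $\Phi=(G,\varphi)$ is a graph $G$ with a function $\varphi$ from oriented edges to $\mathbb{T}$ satisfying $\varphi(\overrightarrow{e_{s,t}})=\varphi(\overrightarrow{e_{t,s}})^{-1}$. It is connected if $G$ is, and its maximum vertex degree is that of $G$. Its adjacency matrix $A(\Phi)$ is the Hermitian $n\times n$ matrix with $(s,t)$ entry $\varphi(\overrightarrow{e_{s,t}})$ if $v_s$ and $v_t$ are adjacent and $0$ otherwise. $K_{p,q}$ denotes the complete bipartite graph with parts of sizes $p$ and $q$. Two $\mathbb{T}$-gain graphs $(G,\varphi_1)$ and $(G,\varphi_2)$ are switching equivalent if there is $\zeta:V(G)\to\mathbb{T}$ with $\varphi_1(\overrightarrow{e_{i,j}})=\zeta(v_i)^{-1}\varphi_2(\overrightarrow{e_{i,j}})\zeta(v_j)$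 for all edges $e_{i,j}$. $(G,1)$ denotes the $\mathbb{T}$-gain graph with all gains equal to $1$. *)

theory Defs
  imports
    "Graph_Theory.Graph_Theory"
    "Jordan_Normal_Form.DL_Rank"
    Complex_Main
begin

text \<open>
  A \<^const>\<open>pair_graph\<close> is a finite simple undirected graph: each undirected edge between
  \<open>u\<close> and \<open>w\<close> is represented by its two orientations \<open>(u, w)\<close> and \<open>(w, u)\<close> in \<^const>\<open>parcs\<close>.
  Values of a gain function outside \<^const>\<open>parcs\<close> are irrelevant.
\<close>

locale unit_gain_graph = pair_graph G for G :: "'a pair_pre_digraph" +
  fixes \<phi> :: "'a \<times> 'a \<Rightarrow> complex"
  assumes gain_unit: "(u, w) \<in> parcs G \<Longrightarrow> norm (\<phi> (u, w)) = 1"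
    and gain_inverse: "(u, w) \<in> parcs G \<Longrightarrow> \<phi> (u, w) = inverse (\<phi> (w, u))"

text \<open>
  The vertices are listed as \<open>v 0, \<dots>, v (n - 1)\<close>, since matrix indices start at \<open>0\<close>.
\<close>

definition gain_adjacency_matrix ::
  "nat \<Rightarrow> (nat \<Rightarrow> 'a) \<Rightarrow> 'a pair_pre_digraph \<Rightarrow> ('a \<times> 'a \<Rightarrow> complex) \<Rightarrow> complex mat" where
  "gain_adjacency_matrix n v G \<phi> =
     mat n n (\<lambda>(s, t). if (v s, v t) \<in> parcs G then \<phi> (v s, v t) else 0)"

text \<open>
  Since both orientations of every edge are arcs, the degree of a vertex of the undirected graph
  is its out-degree.
\<close>

definition max_degree :: "'a pair_pre_digraph \<Rightarrow> nat" where
  "max_degree G = Max (out_degree (with_proj G) ` pverts G)"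

definition switching_equivalent ::
  "'a pair_pre_digraph \<Rightarrow> ('a \<times> 'a \<Rightarrow> complex) \<Rightarrow> ('a \<times> 'a \<Rightarrow> complex) \<Rightarrow> bool" where
  "switching_equivalent G \<phi>1 \<phi>2 \<longleftrightarrow>
     (\<exists>\<zeta>. (\<forall>u \<in> pverts G. norm (\<zeta> u) = 1) \<and>
          (\<forall>(u, w) \<in> parcs G. \<phi>1 (u, w) = inverse (\<zeta> u) * \<phi>2 (u, w) * \<zeta> w))"

text \<open>
  Switching equivalence relates gain functions on the same graph, so being switching equivalent to
  \<open>(K\<^bsub>p,q\<^esub>, 1)\<close> means that the underlying graph is a copy of \<open>K\<^bsub>p,q\<^esub>\<close> (for some choice of the two
  parts) on which \<open>\<phi>\<close> is switching equivalent to the constant gain \<open>1\<close>.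
\<close>

definition switching_equivalent_complete_bipartite ::
  "nat \<Rightarrow> nat \<Rightarrow> 'a pair_pre_digraph \<Rightarrow> ('a \<times> 'a \<Rightarrow> complex) \<Rightarrow> bool" where
  "switching_equivalent_complete_bipartite p q G \<phi> \<longleftrightarrow>
     complete_bipartite_digraph p q (with_proj G) \<and> switching_equivalent G \<phi> (\<lambda>_. 1)"

end

theory Submission
  imports Defs
begin

text \<open>
  Write \<open>d = \<Delta> - 1\<close>, and call a set \<open>S\<close> of vertices independent if the corresponding columns of
  \<open>A(\<Phi>)\<close> are linearly independent. Such a set has at most \<open>r(\<Phi>)\<close> elements, so the inequality
  follows from an independent \<open>S\<close> with \<open>n \<le> |S| d\<close>.

  If the columns of \<open>S\<close> span the column space, then every vertex has a neighbour in \<open>S\<close>, because a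
  row that vanishes on \<open>S\<close> vanishes everywhere and no vertex is isolated. Let \<open>N(S)\<close> be the set of vertices with a neighbour in \<open>S\<close>.
  When \<open>S\<close> is enlarged by an independent vertex that is adjacent to some vertex of \<open>S \<subseteq> N(S)\<close>, at
  most \<open>d\<close> vertices are new in \<open>N(S)\<close>. By connectivity such a step is possible until \<open>S\<close> is a column
  basis (lemma \<open>seed_extends\<close>). So a single small independent set \<open>S\<close> without isolated vertices and
  with \<open>|N(S)| \<le> |S| d\<close>, a seed, proves the bound.

  If no two columns are proportional, no seed is needed. Given a column basis \<open>S\<close>, two vertices
  whose only neighbour in \<open>S\<close> is the same vertex have proportional columns, so at most \<open>|S|\<close> vertices
  have exactly one neighbour in \<open>S\<close> and all others have at least two. Counting the pairs \<open>(s, w)\<close> of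
  adjacent vertices with \<open>s\<close> in \<open>S\<close> gives \<open>2 n \<le> |S| (\<Delta> + 1)\<close> (lemma \<open>twin_free_bound\<close>), which is at most
  \<open>2 |S| d\<close> because \<open>\<Delta> \<ge> 3\<close>.

  If two vertices \<open>l\<close>, \<open>l'\<close> have proportional columns, then \<open>N(l) = N(l')\<close>, hence the neighbourhoods of
  the neighbours of \<open>l\<close> overlap in \<open>l\<close> and \<open>l'\<close>. These overlaps produce a seed with two, three or
  four vertices near \<open>l\<close>, except when the graph is complete bipartite and the columns within each
  part are proportional (lemma \<open>twin_rank_one_bipartition\<close>). In that case the gain graph is switching
  equivalent to \<open>(K\<^bsub>p,q\<^esub>, 1)\<close>, its rank is two and \<open>\<Delta> = max p q\<close>, so that the bound \<open>p + q \<le> 2 d\<close>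
  fails precisely when \<open>p\<close> and \<open>q\<close> differ by at most one.
\<close>

section \<open>Rank and independent sets of column indices\<close>

definition indep_columns :: "'a::field mat \<Rightarrow> nat set \<Rightarrow> bool" where
  "indep_columns A I \<longleftrightarrow>
     (\<forall>c. (\<forall>t<dim_row A. (\<Sum>i\<in>I. A $$ (t, i) * c i) = 0) \<longrightarrow> (\<forall>i\<in>I. c i = 0))"

context vec_space
begin

text \<open>
  The predicate \<open>lin_indpt\<close> speaks about sets of vectors, in which equal columns collapse. Injectivity
  of the column map makes it agree with independence of the index set.
\<close>
lemma lin_indpt_cols_iff:
  fixes A :: "'a mat"
  assumes A: "A \<in> carrier_mat n nc" and I: "I \<subseteq> {..<nc}" and inj: "inj_on (col A) I"
  shows "lin_indpt (col A ` I) \<longleftrightarrow> indep_columns A I"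
proof -
  have fin: "finite I" using I finite_subset by blast
  have car: "col A ` I \<subseteq> carrier_vec n" using A I by auto
  have index: "lincomb a (col A ` I) $ t = (\<Sum>i\<in>I. A $$ (t, i) * a (col A i))" if "t < n" for a t
  proof -
    have "lincomb a (col A ` I) $ t = (\<Sum>x\<in>col A ` I. a x * x $ t)"
      by (rule lincomb_index[OF that car])
    also have "\<dots> = (\<Sum>i\<in>I. a (col A i) * col A i $ t)"
      by (simp add: sum.reindex[OF inj])
    also have "\<dots> = (\<Sum>i\<in>I. A $$ (t, i) * a (col A i))"
      using A I that by (intro sum.cong) auto
    finally show ?thesis .
  qed
  show ?thesis
  proof
    assume li: "lin_indpt (col A ` I)"
    show "indep_columns A I"
      unfolding indep_columns_def
    proof (intro allI impI)
      fix c assume c: "\<forall>t<dim_row A. (\<Sum>i\<in>I. A $$ (t, i) * c i) = 0"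
      define a where "a x = c (the_inv_into I (col A) x)" for x
      have a: "a (col A i) = c i" if "i \<in> I" for i
        using that by (simp add: a_def the_inv_into_f_f[OF inj])
      have "lincomb a (col A ` I) = 0\<^sub>v n"
      proof (rule eq_vecI)
        show "dim_vec (lincomb a (col A ` I)) = dim_vec (0\<^sub>v n :: 'a vec)"
          using lincomb_dim[OF _ car] fin by simp
      next
        fix t assume "t < dim_vec (0\<^sub>v n :: 'a vec)"
        then show "lincomb a (col A ` I) $ t = 0\<^sub>v n $ t"
          using c A a by (simp add: index)
      qed
      then have "\<forall>x\<in>col A ` I. a x = 0"
        using li fin lin_dep_crit[where A = "col A ` I" and S = "col A ` I" and a = a] by auto
      then show "\<forall>i\<in>I. c i = 0" using a by simp
    qed
  next
    assume ind: "indep_columns A I"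
    show "lin_indpt (col A ` I)"
    proof
      assume "lin_dep (col A ` I)"
      then obtain a x where ax: "lincomb a (col A ` I) = 0\<^sub>v n" "x \<in> col A ` I" "a x \<noteq> 0"
        using finite_lin_dep[of "col A ` I"] fin car by auto
      have "(\<Sum>i\<in>I. A $$ (t, i) * a (col A i)) = 0" if "t < dim_row A" for t
        using index[of t a] that A ax(1) by simp
      then have "\<forall>i\<in>I. a (col A i) = 0"
        using ind[unfolded indep_columns_def, rule_format, of "\<lambda>i. a (col A i)"] by blast
      then show False using ax by auto
    qed
  qed
qed

text \<open>
  Two equal columns with different indices would satisfy the relation with coefficients \<open>1\<close> and \<open>-1\<close>.
\<close>
lemma indep_columns_inj:
  fixes A :: "'a mat"
  assumes A: "A \<in> carrier_mat n nc" and I: "I \<subseteq> {..<nc}" and ind: "indep_columns A I"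
  shows "inj_on (col A) I"
proof (rule inj_onI, rule ccontr)
  fix i j assume ij: "i \<in> I" "j \<in> I" "col A i = col A j" "i \<noteq> j"
  have fin: "finite I" using I finite_subset by blast
  define c :: "nat \<Rightarrow> 'a" where "c k = (if k = i then 1 else if k = j then -1 else 0)" for k
  have "(\<Sum>k\<in>I. A $$ (t, k) * c k) = 0" if t: "t < dim_row A" for t
  proof -
    have Aij: "A $$ (t, i) = A $$ (t, j)"
    proof -
      have "i < nc" "j < nc" using I ij(1,2) by auto
      then have "A $$ (t, i) = col A i $ t" "A $$ (t, j) = col A j $ t"
        using t A by auto
      then show ?thesis using ij(3) by simp
    qed
    have ci: "c i = 1" and cj: "c j = -1" using ij(4) by (simp_all add: c_def)
    have "(\<Sum>k\<in>I. A $$ (t, k) * c k) = (\<Sum>k\<in>{i, j}. A $$ (t, k) * c k)"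
      using ij(1,2) fin by (intro sum.mono_neutral_right) (auto simp: c_def)
    also have "\<dots> = A $$ (t, i) * c i + A $$ (t, j) * c j"
      using ij(4) by simp
    finally show ?thesis by (simp only: ci cj Aij) simp
  qed
  then have "c i = 0" using ind ij(1) unfolding indep_columns_def by blast
  then show False by (simp add: c_def)
qed

lemma card_indep_columns_le_rank:
  assumes "A \<in> carrier_mat n nc" "I \<subseteq> {..<nc}" "indep_columns A I"
  shows "card I \<le> rank A"
proof -
  have inj: "inj_on (col A) I" by (rule indep_columns_inj[OF assms])
  have "col A ` I \<subseteq> set (cols A)" using assms by (auto simp: cols_def)
  then have "card (col A ` I) \<le> rank A"
    using rank_ge_card_indpt[OF assms(1)] lin_indpt_cols_iff[OF assms(1,2) inj] assms(3) by blast
  then show ?thesis by (simp add: card_image[OF inj])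
qed

lemma rank_attained_by_indep_columns:
  assumes A: "A \<in> carrier_mat n nc"
  obtains I where "I \<subseteq> {..<nc}" "indep_columns A I" "card I = rank A"
proof -
  let ?P = "\<lambda>T. T \<subseteq> set (cols A) \<and> lin_indpt T"
  have "lin_indpt {}" unfolding lin_dep_def by blast
  then have "\<exists>U. finite U \<and> maximal U ?P \<and> {} \<subseteq> U"
    by (intro maximal_exists_superset[where S = "set (cols A)"]) simp_all
  then obtain U where U: "maximal U ?P" by (elim exE conjE)
  then have "U \<subseteq> set (cols A)" and li: "lin_indpt U"
    unfolding maximal_def by blast+
  moreover have "set (cols A) = col A ` {..<nc}"
    using A by (auto simp: cols_def)
  ultimately have "U \<subseteq> col A ` {..<nc}" by simp
  then obtain I where I: "I \<subseteq> {..<nc}" "inj_on (col A) I" "U = col A ` I"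
    unfolding subset_image_inj by metis
  show thesis
  proof
    show "indep_columns A I" using li lin_indpt_cols_iff[OF A I(1,2)] I(3) by simp
    show "card I = rank A" using rank_card_indpt[OF A U] I(3) card_image[OF I(2)] by simp
  qed (rule I(1))
qed

end

section \<open>Hermitian weightings\<close>

text \<open>
  The lower bound does not depend on the absolute values of the gains, so it is proved for arbitrary
  Hermitian edge weights. Modulus one matters only for the passage between gains and weights: it makes
  the weights Hermitian and the factors in a rank-one block a switching function.
\<close>
locale hermitian_weighting =
  fixes V :: "'a set" and M :: "'a \<Rightarrow> 'a \<Rightarrow> complex"
  assumes finite_V: "finite V"
    and support: "M u w \<noteq> 0 \<Longrightarrow> u \<in> V \<and> w \<in> V"
    and hermitian: "M w u = cnj (M u w)"
    and diag_zero: "M u u = 0"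
begin

definition nbrs :: "'a \<Rightarrow> 'a set" where
  "nbrs u = {w. M u w \<noteq> 0}"

definition covered :: "'a set \<Rightarrow> 'a set" where
  "covered S = (\<Union>s\<in>S. nbrs s)"

definition proportional :: "'a \<Rightarrow> 'a \<Rightarrow> bool" where
  "proportional u w \<longleftrightarrow> (\<exists>k. k \<noteq> 0 \<and> (\<forall>t. M t u = k * M t w))"

definition spanned :: "'a set \<Rightarrow> 'a \<Rightarrow> bool" where
  "spanned S u \<longleftrightarrow> (\<exists>c. \<forall>t. M t u = (\<Sum>s\<in>S. M t s * c s))"

definition indep :: "'a set \<Rightarrow> bool" where
  "indep S \<longleftrightarrow> S \<subseteq> V \<and> (\<forall>c. (\<forall>t. (\<Sum>s\<in>S. M t s * c s) = 0) \<longrightarrow> (\<forall>s\<in>S. c s = 0))"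

lemma M_zero_sym: "M u w = 0 \<longleftrightarrow> M w u = 0"
  by (subst hermitian) simp

lemma in_nbrs: "w \<in> nbrs u \<longleftrightarrow> M u w \<noteq> 0"
  by (simp add: nbrs_def)

lemma in_nbrs': "w \<in> nbrs u \<longleftrightarrow> M w u \<noteq> 0"
  using M_zero_sym[of u w] by (simp add: nbrs_def)

lemma nbrs_sym: "u \<in> nbrs w \<longleftrightarrow> w \<in> nbrs u"
  using M_zero_sym[of u w] by (simp add: nbrs_def)

lemma not_in_own_nbrs [simp]: "u \<notin> nbrs u"
  by (simp add: in_nbrs diag_zero)

lemma nbrs_subset: "nbrs u \<subseteq> V"
  using support by (auto simp: nbrs_def)

lemma finite_nbrs [simp]: "finite (nbrs u)"
  using finite_subset[OF nbrs_subset finite_V] .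

lemma in_nbrs_V: "w \<in> nbrs u \<Longrightarrow> u \<in> V"
  using support by (auto simp: nbrs_def)

lemma covered_insert [simp]: "covered (insert u S) = nbrs u \<union> covered S"
  by (simp add: covered_def)

lemma covered_empty [simp]: "covered {} = {}"
  by (simp add: covered_def)

lemma covered_subset: "covered S \<subseteq> V"
  using nbrs_subset by (auto simp: covered_def)

lemma finite_covered [simp]: "finite (covered S)"
  using finite_subset[OF covered_subset finite_V] .

lemma proportional_refl: "proportional u u"
  unfolding proportional_def by (intro exI[of _ 1]) simp

lemma proportional_sym: "proportional u w \<Longrightarrow> proportional w u"
proof -
  assume "proportional u w"
  then obtain k where "k \<noteq> 0" "\<forall>t. M t u = k * M t w" by (auto simp: proportional_def)
  then show ?thesis unfolding proportional_def by (intro exI[of _ "inverse k"]) simp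
qed

lemma proportional_trans: "proportional u w \<Longrightarrow> proportional w x \<Longrightarrow> proportional u x"
proof -
  assume "proportional u w" "proportional w x"
  then obtain k l where "k \<noteq> 0" "\<forall>t. M t u = k * M t w" "l \<noteq> 0" "\<forall>t. M t w = l * M t x"
    unfolding proportional_def by blast
  then show ?thesis unfolding proportional_def by (intro exI[of _ "k * l"]) simp
qed

lemma proportional_nbrs: "proportional u w \<Longrightarrow> nbrs u = nbrs w"
  by (auto simp: proportional_def in_nbrs')

lemma indep_subset_V: "indep S \<Longrightarrow> S \<subseteq> V"
  by (simp add: indep_def)

lemma indep_finite: "indep S \<Longrightarrow> finite S"
  using finite_subset[OF _ finite_V] by (simp add: indep_def)

lemma indep_empty: "indep {}"
  by (simp add: indep_def)

lemma spanned_self: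
  assumes "finite S" "u \<in> S"
  shows "spanned S u"
proof -
  have "M t u = (\<Sum>s\<in>S. M t s * of_bool (s = u))" for t
    using assms by (simp add: sum.remove)
  then show ?thesis
    unfolding spanned_def by (intro exI[of _ "\<lambda>s. of_bool (s = u)"] allI)
qed

lemma indep_insert:
  assumes S: "indep S" and u: "u \<in> V" and nspan: "\<not> spanned S u"
  shows "indep (insert u S)"
proof -
  have fin: "finite S" by (rule indep_finite[OF S])
  have uS: "u \<notin> S" using spanned_self[OF fin] nspan by blast
  have "\<forall>s\<in>insert u S. c s = 0" if c: "\<forall>t. (\<Sum>s\<in>insert u S. M t s * c s) = 0" for c
  proof -
    have eq: "M t u * c u + (\<Sum>s\<in>S. M t s * c s) = 0" for t
      using c[rule_format, of t] fin uS by simp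
    have cu: "c u = 0"
    proof (rule ccontr)
      assume nz: "c u \<noteq> 0"
      have "M t u = (\<Sum>s\<in>S. M t s * (- c s / c u))" for t
      proof -
        have "(\<Sum>s\<in>S. M t s * (- c s / c u)) = - (\<Sum>s\<in>S. M t s * c s) / c u"
          by (simp add: sum_divide_distrib sum_negf)
        also have "\<dots> = M t u" using eq[of t] nz by (simp add: field_simps add_eq_0_iff)
        finally show ?thesis by simp
      qed
      then have "spanned S u" unfolding spanned_def
        by (intro exI[of _ "\<lambda>s. - c s / c u"] allI)
      then show False using nspan by contradiction
    qed
    then have "\<forall>t. (\<Sum>s\<in>S. M t s * c s) = 0" using eq by simp
    then have "\<forall>s\<in>S. c s = 0" using S unfolding indep_def by blast
    then show ?thesis using cu by simp
  qed
  then show ?thesis using S u unfolding indep_def by blast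
qed

text \<open>
  A column is not a combination of others if some row is nonzero in it and vanishes in all of them.
  The seeds below are proved independent by this criterion, starting from one or two columns.
\<close>
lemma indep_insert_private:
  assumes S: "indep S" and tu: "t \<in> nbrs u" and tS: "\<And>s. s \<in> S \<Longrightarrow> t \<notin> nbrs s"
  shows "indep (insert u S)"
proof (rule indep_insert[OF S])
  show "u \<in> V" using tu by (rule in_nbrs_V)
  show "\<not> spanned S u"
  proof
    assume "spanned S u"
    then obtain c where "M t u = (\<Sum>s\<in>S. M t s * c s)" by (auto simp: spanned_def)
    then show False using tu tS by (simp add: in_nbrs')
  qed
qed

lemma indep_nonproportional:
  assumes "\<not> proportional u w" "nbrs u \<noteq> {}" "nbrs w \<noteq> {}"
  shows "indep {u, w}"
proof -
  obtain t where t: "t \<in> nbrs w" using assms(3) by blast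
  obtain t' where t': "M t' u \<noteq> 0" using assms(2) in_nbrs' by blast
  have "indep {w}" using indep_insert_private[OF indep_empty t] by simp
  moreover have "u \<in> V" using support[OF t'] by simp
  moreover have "\<not> spanned {w} u"
  proof
    assume "spanned {w} u"
    then obtain c where c: "\<forall>t. M t u = M t w * c w" by (auto simp: spanned_def)
    then have "c w \<noteq> 0" using t' by auto
    then have "proportional u w" unfolding proportional_def
      using c by (intro exI[of _ "c w"]) (simp add: mult.commute)
    then show False using assms(1) by simp
  qed
  ultimately show ?thesis by (rule indep_insert)
qed

lemma indep_proportional_eq:
  assumes S: "indep S" and uw: "u \<in> S" "w \<in> S" "proportional u w"
  shows "u = w"
proof (rule ccontr)
  assume ne: "u \<noteq> w"
  have fin: "finite S" by (rule indep_finite[OF S])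
  obtain k where k: "\<forall>t. M t u = k * M t w" using uw(3) by (auto simp: proportional_def)
  define c where "c s = (if s = u then 1 else if s = w then - k else 0)" for s
  have "(\<Sum>s\<in>S. M t s * c s) = 0" for t
  proof -
    have "(\<Sum>s\<in>S. M t s * c s) = (\<Sum>s\<in>{u, w}. M t s * c s)"
      using uw fin by (intro sum.mono_neutral_right) (auto simp: c_def)
    then show ?thesis using ne k by (simp add: c_def)
  qed
  then have "c u = 0" using S uw(1) unfolding indep_def by blast
  then show False by (simp add: c_def)
qed

lemma indep_edge:
  assumes "w \<in> nbrs u"
  shows "indep {u, w}"
proof -
  have "u \<in> nbrs w" using assms nbrs_sym by blast
  then have "indep {w}" using indep_insert_private[OF indep_empty] by blast
  then show ?thesis using indep_insert_private[of "{w}" w u] assms by simp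
qed

text \<open>
  Maximality is taken among the independent sets with property \<open>P\<close>. With the trivial \<open>P\<close> this
  yields a column basis; with the growth condition of a seed it replaces a step-by-step extension.
\<close>
lemma indep_maximal_exists:
  assumes "indep S0" "P S0"
  obtains S where "indep S" "P S"
    "\<And>u. u \<in> V \<Longrightarrow> P (insert u S) \<Longrightarrow> spanned S u"
proof -
  let ?Q = "\<lambda>S. indep S \<and> P S"
  obtain S where S: "maximal S ?Q"
    using maximal_exists_superset[of V ?Q S0] finite_V indep_subset_V assms by blast
  show thesis
  proof
    show "indep S" "P S" using S by (auto simp: maximal_def)
    fix u assume u: "u \<in> V" "P (insert u S)"
    show "spanned S u"
    proof (rule ccontr)
      assume ns: "\<not> spanned S u"
      then have "?Q (insert u S)" using indep_insert[OF \<open>indep S\<close> u(1)] u(2) by simp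
      then have "insert u S = S" using S unfolding maximal_def by blast
      then show False using ns spanned_self[OF indep_finite[OF \<open>indep S\<close>], of u] by blast
    qed
  qed
qed

text \<open>
  For the contrapositive: a spanned vertex adjacent to \<open>t\<close> forces a neighbour of \<open>t\<close> inside \<open>S\<close>.
\<close>
lemma spanned_zero:
  assumes "spanned S u" "\<And>s. s \<in> S \<Longrightarrow> M t s = 0"
  shows "M t u = 0"
proof -
  obtain c where "M t u = (\<Sum>s\<in>S. M t s * c s)" using assms(1) by (auto simp: spanned_def)
  then show ?thesis using assms(2) by simp
qed

text \<open>
  For a column basis \<open>S\<close>, let \<open>m w\<close> be the number of neighbours of \<open>w\<close> in \<open>S\<close>. Then \<open>m\<close> is positive
  on the vertices, and its sum over them is the sum of the degrees over \<open>S\<close>. The vertices with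
  \<open>m w = 1\<close> inject into \<open>S\<close> by their unique neighbour there: by Hermitian symmetry every row is a
  combination of the rows in \<open>S\<close>, so two columns that agree up to a factor on the rows in \<open>S\<close> are
  proportional.
\<close>
lemma twin_free_bound:
  assumes iso: "\<And>u. u \<in> V \<Longrightarrow> nbrs u \<noteq> {}"
    and deg: "\<And>u. card (nbrs u) \<le> D"
    and twin_free: "\<And>u w. u \<in> V \<Longrightarrow> w \<in> V \<Longrightarrow> proportional u w \<Longrightarrow> u = w"
  obtains S where "indep S" "2 * card V \<le> card S * (D + 1)"
proof -
  obtain S where S: "indep S" and span: "\<And>u. u \<in> V \<Longrightarrow> spanned S u"
    using indep_maximal_exists[OF indep_empty, of "\<lambda>_. True"] by auto
  have fin: "finite S" and SV: "S \<subseteq> V" using S by (rule indep_finite, rule indep_subset_V)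
  define m where "m w = card (nbrs w \<inter> S)" for w
  have m_pos: "m w \<ge> 1" if w: "w \<in> V" for w
  proof -
    obtain u where u: "M w u \<noteq> 0" using iso[OF w] by (auto simp: nbrs_def)
    then have "spanned S u" using span support by blast
    then obtain s where "s \<in> S" "M w s \<noteq> 0" using spanned_zero u by blast
    then have "nbrs w \<inter> S \<noteq> {}" by (auto simp: in_nbrs)
    then show ?thesis unfolding m_def by (simp add: Suc_leI card_gt_0_iff)
  qed
  define W where "W = {w \<in> V. m w = 1}"
  define f where "f w = the_elem (nbrs w \<inter> S)" for w
  have f: "nbrs w \<inter> S = {f w}" if "w \<in> W" for w
  proof -
    have "card (nbrs w \<inter> S) = 1" using that by (simp add: W_def m_def)
    then obtain s where "nbrs w \<inter> S = {s}" by (auto simp: card_1_singleton_iff)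
    then show ?thesis by (simp add: f_def)
  qed
  have "inj_on f W"
  proof (rule inj_onI)
    fix w x assume wx: "w \<in> W" "x \<in> W" "f w = f x"
    define s where "s = f w"
    have sw: "nbrs w \<inter> S = {s}" and sx: "nbrs x \<inter> S = {s}" using f wx by (auto simp: s_def)
    then have "s \<in> nbrs w" "s \<in> nbrs x" and sS: "s \<in> S" by blast+
    then have nz: "M s w \<noteq> 0" "M s x \<noteq> 0" by (simp_all add: in_nbrs')
    have z: "M t w = 0 \<and> M t x = 0" if "t \<in> S" "t \<noteq> s" for t
    proof -
      have "t \<notin> nbrs w" "t \<notin> nbrs x" using that sw sx by blast+
      then show ?thesis by (simp add: in_nbrs')
    qed
    \<comment> \<open>On the rows in \<open>S\<close> both columns are supported at \<open>s\<close>, so this ratio must be the factor.\<close>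
    define k where "k = M s w / M s x"
    have "M t w = k * M t x" for t
    proof (cases "t \<in> V")
      case False
      then have "M t w = 0" "M t x = 0" using support by blast+
      then show ?thesis by simp
    next
      case True
      then obtain c where c: "\<forall>r. M r t = (\<Sum>s\<in>S. M r s * c s)"
        using span by (auto simp: spanned_def)
      have row: "M t y = (\<Sum>r\<in>S. M r y * cnj (c r))" for y
      proof -
        have "M t y = cnj (M y t)" by (rule hermitian)
        also have "\<dots> = (\<Sum>r\<in>S. cnj (M y r) * cnj (c r))" by (simp add: c)
        also have "\<dots> = (\<Sum>r\<in>S. M r y * cnj (c r))" by (simp flip: hermitian)
        finally show ?thesis .
      qed
      have "M t w = M s w * cnj (c s)" "M t x = M s x * cnj (c s)"
        using row[of w] row[of x] z by (simp_all add: sum.remove[OF fin sS])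
      then show ?thesis using nz by (simp add: k_def)
    qed
    moreover have "k \<noteq> 0" using nz by (simp add: k_def)
    ultimately have "proportional w x" unfolding proportional_def by blast
    then show "w = x" using twin_free wx by (simp add: W_def)
  qed
  moreover have "f ` W \<subseteq> S" using f by blast
  ultimately have cardW: "card W \<le> card S" using fin by (metis card_image card_mono)
  have "(\<Sum>w\<in>V. m w) = (\<Sum>w\<in>V. \<Sum>s\<in>S. if s \<in> nbrs w then 1 else 0)"
    unfolding m_def using fin by (intro sum.cong refl) (simp add: sum.If_cases Int_def conj_commute)
  also have "\<dots> = (\<Sum>s\<in>S. \<Sum>w\<in>V. if s \<in> nbrs w then 1 else 0)"
    by (rule sum.swap)
  also have "\<dots> = (\<Sum>s\<in>S. card (nbrs s))"
  proof (intro sum.cong refl)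
    fix s assume "s \<in> S"
    have "{w \<in> V. s \<in> nbrs w} = nbrs s" using nbrs_subset nbrs_sym by blast
    then show "(\<Sum>w\<in>V. if s \<in> nbrs w then 1 else 0) = card (nbrs s)"
      using finite_V by (simp add: sum.If_cases Int_def)
  qed
  also have "\<dots> \<le> card S * D" using sum_bounded_above[of S "\<lambda>s. card (nbrs s)" D] deg by simp
  finally have upper: "(\<Sum>w\<in>V. m w) \<le> card S * D" .
  have "2 * card V = (\<Sum>w\<in>V. 2)" by simp
  also have "\<dots> \<le> (\<Sum>w\<in>V. m w + (if w \<in> W then 1 else 0))"
    using m_pos by (intro sum_mono) (force simp: W_def)
  also have "\<dots> = (\<Sum>w\<in>V. m w) + card W"
    using finite_V by (simp add: sum.distrib sum.If_cases W_def Int_def)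
  finally have "2 * card V \<le> card S * D + card S" using upper cardW by linarith
  then show thesis using S that by simp
qed

text \<open>
  The complete bipartite graphs whose off-diagonal block has rank one. For weights of modulus one
  these are the gain graphs switching equivalent to \<open>(K\<^bsub>p,q\<^esub>, 1)\<close>.
\<close>
definition rank_one_bipartition :: "'a set \<Rightarrow> 'a set \<Rightarrow> bool" where
  "rank_one_bipartition A B \<longleftrightarrow> A \<inter> B = {} \<and> A \<union> B = V \<and>
     (\<forall>a\<in>A. nbrs a = B) \<and> (\<forall>b\<in>B. nbrs b = A) \<and>
     (\<forall>a\<in>A. \<forall>a'\<in>A. proportional a a') \<and> (\<forall>b\<in>B. \<forall>b'\<in>B. proportional b b')"

lemma indep_card_le_2:
  assumes bip: "rank_one_bipartition A B" and S: "indep S"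
  shows "card S \<le> 2"
proof -
  have fin: "finite S" by (rule indep_finite[OF S])
  have le1: "card (S \<inter> C) \<le> 1" if C: "\<forall>x\<in>C. \<forall>y\<in>C. proportional x y" for C
    using indep_proportional_eq[OF S] C fin by (auto simp: card_le_Suc0_iff_eq)
  have "S = (S \<inter> A) \<union> (S \<inter> B)"
    using indep_subset_V[OF S] bip by (auto simp: rank_one_bipartition_def)
  then have "card S \<le> card (S \<inter> A) + card (S \<inter> B)" by (metis card_Un_le)
  also have "\<dots> \<le> 1 + 1"
    using le1[of A] le1[of B] bip unfolding rank_one_bipartition_def by (intro add_mono) blast+
  finally show ?thesis by simp
qed

end

section \<open>Covering the vertices of a connected weighting\<close>

text \<open>
  The parameter \<open>d\<close> plays the role of \<open>\<Delta> - 1\<close>, which keeps natural-number subtraction out of the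
  counting arguments.
\<close>
locale connected_weighting = hermitian_weighting V M
  for V :: "'a set" and M :: "'a \<Rightarrow> 'a \<Rightarrow> complex" +
  fixes d :: nat
  assumes card_nbrs_le: "card (nbrs u) \<le> d + 1"
    and d_ge_2: "d \<ge> 2"
    and card_V: "card V \<ge> 2"
    and connected: "P \<subseteq> V \<Longrightarrow> P \<noteq> {} \<Longrightarrow> P \<noteq> V \<Longrightarrow> \<exists>p\<in>P. \<exists>u\<in>V - P. M p u \<noteq> 0"
begin

lemma nbrs_nonempty:
  assumes "u \<in> V"
  shows "nbrs u \<noteq> {}"
proof -
  have "{u} \<noteq> V" using card_V by auto
  then have "\<exists>p\<in>{u}. \<exists>w\<in>V - {u}. M p w \<noteq> 0" using assms by (intro connected) auto
  then show ?thesis by (auto simp: nbrs_def)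
qed

text \<open>
  The condition \<open>S \<subseteq> covered S\<close> says that the subgraph induced by \<open>S\<close> has no isolated vertex. It
  guarantees that a new vertex attached to \<open>S\<close> has at most \<open>d\<close> neighbours that are not yet covered.
\<close>
definition seed :: "'a set \<Rightarrow> bool" where
  "seed S \<longleftrightarrow> indep S \<and> S \<noteq> {} \<and> S \<subseteq> covered S \<and> card (covered S) \<le> card S * d"

text \<open>
  Take a maximal seed \<open>S\<close>. If it did not span all columns, connectivity would give an edge from a
  spanned vertex \<open>p\<close> to a vertex \<open>x\<close> that is not spanned. Because the column of \<open>p\<close> is a combination of
  columns of \<open>S\<close>, the vertex \<open>x\<close> also has a neighbour \<open>s\<close> in \<open>S\<close>. This \<open>s\<close> is already covered, so
  adding \<open>x\<close> would give a larger seed. A spanning \<open>S\<close> covers all vertices.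
\<close>
lemma seed_extends:
  assumes "seed S0"
  obtains S where "indep S" "card V \<le> card S * d"
proof -
  let ?P = "\<lambda>S. S \<noteq> {} \<and> S \<subseteq> covered S \<and> card (covered S) \<le> card S * d"
  have "indep S0" "?P S0" using assms by (simp_all add: seed_def)
  then obtain S where S: "indep S" "?P S"
    and max: "\<forall>u\<in>V. ?P (insert u S) \<longrightarrow> spanned S u"
    using indep_maximal_exists[where P = ?P] by (metis (no_types, lifting))
  have fin: "finite S" by (rule indep_finite[OF S(1)])
  have span: "spanned S u" if "u \<in> V" for u
  proof (rule ccontr)
    assume nspan: "\<not> spanned S u"
    define C where "C = {u \<in> V. spanned S u}"
    have "S \<subseteq> C" using spanned_self[OF fin] indep_subset_V[OF S(1)] by (auto simp: C_def)
    then have "C \<noteq> {}" using S(2) by blast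
    moreover have "C \<noteq> V" using that nspan by (auto simp: C_def)
    ultimately obtain p x where px: "p \<in> C" "x \<in> V - C" "M p x \<noteq> 0"
      using connected[of C] by (auto simp: C_def)
    have "M x p \<noteq> 0" using px(3) M_zero_sym by blast
    moreover have "spanned S p" using px(1) by (simp add: C_def)
    ultimately obtain s where s: "s \<in> S" "M x s \<noteq> 0" using spanned_zero by blast
    have xS: "x \<notin> S" using \<open>S \<subseteq> C\<close> px(2) by blast
    have s_x: "s \<in> nbrs x" using s(2) by (simp add: in_nbrs)
    then have x_s: "x \<in> nbrs s" using nbrs_sym by blast
    have "s \<in> covered S" using s(1) S(2) by blast
    then have "nbrs x \<union> covered S = (nbrs x - {s}) \<union> covered S" by blast
    then have "card (covered (insert x S)) \<le> card (nbrs x - {s}) + card (covered S)"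
      by (simp add: card_Un_le)
    also have "\<dots> \<le> d + card S * d"
      using card_nbrs_le[of x] s_x S(2) by (intro add_mono) simp_all
    finally have "card (covered (insert x S)) \<le> card (insert x S) * d"
      using xS fin by simp
    moreover have "x \<in> covered S" using x_s s(1) by (auto simp: covered_def)
    ultimately have "?P (insert x S)" using S(2) by auto
    then have "spanned S x" using max px(2) by blast
    then show False using px(2) by (simp add: C_def)
  qed
  have "V \<subseteq> covered S"
  proof
    fix w assume w: "w \<in> V"
    obtain u where u: "M w u \<noteq> 0" using nbrs_nonempty[OF w] by (auto simp: nbrs_def)
    then have "spanned S u" using span support by blast
    then obtain s where "s \<in> S" "M w s \<noteq> 0" using spanned_zero u by blast
    then show "w \<in> covered S" by (auto simp: covered_def in_nbrs')
  qed
  then have "card V \<le> card (covered S)" by (intro card_mono) simp_all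
  then show thesis using S that[of S] by simp
qed

lemma card_Un_nbrs_le:
  assumes "finite C" "F \<subseteq> nbrs u" "F \<subseteq> C"
  shows "card (nbrs u \<union> C) + card F \<le> d + 1 + card C"
proof -
  have "card (nbrs u \<union> C) + card (nbrs u \<inter> C) = card (nbrs u) + card C"
    using card_Un_Int[of "nbrs u" C] assms(1) by simp
  moreover have "card F \<le> card (nbrs u \<inter> C)" using assms by (intro card_mono) auto
  ultimately show ?thesis using card_nbrs_le[of u] by simp
qed

text \<open>
  Assuming that there is no seed, small candidates near two vertices \<open>l\<close> and \<open>l'\<close> with proportional
  columns force more and more structure, until only a rank-one bipartition remains.
\<close>
context
  fixes l l'
  assumes l: "l \<in> V" "l \<noteq> l'" "proportional l l'"
    and no_seed: "\<And>S. \<not> seed S"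
begin

lemma twin_common: "b \<in> nbrs l \<Longrightarrow> {l, l'} \<subseteq> nbrs b"
  using proportional_nbrs[OF l(3)] nbrs_sym by auto

text \<open>
  The ends of an edge between two neighbours of \<open>l\<close> would have the common neighbours \<open>l\<close> and \<open>l'\<close>, hence
  cover at most \<open>2 (d + 1) - 2\<close> vertices.
\<close>
lemma twin_nbrs_independent:
  assumes b: "b \<in> nbrs l" and w: "w \<in> nbrs l"
  shows "w \<notin> nbrs b"
proof
  assume wb: "w \<in> nbrs b"
  then have bw: "b \<in> nbrs w" and ne: "b \<noteq> w" using nbrs_sym by auto
  have "card (nbrs b \<union> nbrs w) + card {l, l'} \<le> d + 1 + card (nbrs w)"
    using twin_common b w by (intro card_Un_nbrs_le) simp_all
  then have "card (covered {b, w}) \<le> card {b, w} * d"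
    using card_nbrs_le[of w] l(2) ne by simp
  then have "seed {b, w}"
    using indep_edge[OF wb] wb bw by (simp add: seed_def)
  then show False using no_seed by blast
qed

text \<open>
  The path \<open>b\<close>, \<open>l\<close>, \<open>w\<close> is independent and covers at most \<open>3 (d + 1) - 2 = 3 d + 1\<close> vertices,
  one too many for a seed. Not being a seed, it attains this bound, which makes every
  estimate used an equality.
\<close>
lemma twin_nbrs_nonproportional:
  assumes b: "b \<in> nbrs l" and w: "w \<in> nbrs l" and np: "\<not> proportional b w"
  shows "nbrs b \<inter> nbrs w = {l, l'}" "card (nbrs l) = d + 1" "card (nbrs b) = d + 1"
proof -
  have ne: "b \<noteq> w" using np proportional_refl by blast
  have lbw: "l \<noteq> b" "l \<noteq> w" using b w by auto
  have lb: "l \<in> nbrs b" and lw: "l \<in> nbrs w" using b w nbrs_sym by blast+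
  have "indep {b, w}" using np lb lw by (intro indep_nonproportional) auto
  then have "indep {l, b, w}"
    using twin_nbrs_independent[OF w b] b by - (rule indep_insert_private[of _ b], auto)
  moreover have "{l, b, w} \<subseteq> covered {l, b, w}" using b w lb by simp
  ultimately have "\<not> card (covered {l, b, w}) \<le> card {l, b, w} * d"
    using no_seed[of "{l, b, w}"] by (simp add: seed_def)
  then have "3 * d + 1 \<le> card (nbrs l \<union> (nbrs b \<union> nbrs w))"
    using ne lbw by simp
  also have "\<dots> \<le> card (nbrs l) + card (nbrs b \<union> nbrs w)" by (rule card_Un_le)
  finally have "3 * d + 1 + card (nbrs b \<inter> nbrs w) \<le> card (nbrs l) + card (nbrs b) + card (nbrs w)"
    using card_Un_Int[of "nbrs b" "nbrs w"] by simp
  moreover have sub: "{l, l'} \<subseteq> nbrs b \<inter> nbrs w" using twin_common b w by blast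
  then have "card {l, l'} \<le> card (nbrs b \<inter> nbrs w)" by (intro card_mono) auto
  then have "2 \<le> card (nbrs b \<inter> nbrs w)" using l(2) by simp
  ultimately have *: "card (nbrs b \<inter> nbrs w) = 2 \<and> card (nbrs l) = d + 1 \<and> card (nbrs b) = d + 1"
    using card_nbrs_le[of l] card_nbrs_le[of b] card_nbrs_le[of w] by linarith
  then show "card (nbrs l) = d + 1" "card (nbrs b) = d + 1" by simp_all
  have "card {l, l'} = card (nbrs b \<inter> nbrs w)" using * l(2) by simp
  then show "nbrs b \<inter> nbrs w = {l, l'}" using card_subset_eq[OF _ sub] by simp
qed

lemma private_nbr:
  assumes "b \<in> nbrs l" "w \<in> nbrs l" "\<not> proportional b w"
  obtains x where "x \<in> nbrs b" "x \<notin> {l, l'}"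
proof -
  have "card (nbrs b) = d + 1" using twin_nbrs_nonproportional assms by blast
  then have "card {l, l'} < card (nbrs b)" using d_ge_2 l(2) by simp
  then have "\<not> nbrs b \<subseteq> {l, l'}" by (meson card_mono finite.emptyI finite.insertI not_le)
  then show thesis using that by blast
qed

text \<open>
  The star with centre \<open>l\<close> and leaves \<open>b\<close>, \<open>w\<close>, \<open>z\<close>: the leaves pairwise share exactly \<open>l\<close> and \<open>l'\<close>, so
  each has a private neighbour, and the star covers at most \<open>(d + 1) + (d + 1) + 2 (d - 1) = 4 d\<close>
  vertices.
\<close>
lemma no_three_classes:
  assumes b: "b \<in> nbrs l" and w: "w \<in> nbrs l" and z: "z \<in> nbrs l"
    and bw: "\<not> proportional b w" and bz: "\<not> proportional b z" and wz: "\<not> proportional w z"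
  shows False
proof -
  have zw: "\<not> proportional z w" using wz proportional_sym by blast
  have distinct: "b \<noteq> w" "b \<noteq> z" "w \<noteq> z" "l \<noteq> b" "l \<noteq> w" "l \<noteq> z"
    using bw bz wz b w z proportional_refl by auto
  have lb: "l \<in> nbrs b" and lw: "l \<in> nbrs w" and lz: "l \<in> nbrs z"
    using b w z nbrs_sym by blast+
  note Ibw = twin_nbrs_nonproportional(1)[OF b w bw]
  note Ibz = twin_nbrs_nonproportional(1)[OF b z bz]
  note Iwz = twin_nbrs_nonproportional(1)[OF w z wz]
  obtain y where y: "y \<in> nbrs w" "y \<notin> {l, l'}" using private_nbr[OF w z wz] .
  obtain x where x: "x \<in> nbrs z" "x \<notin> {l, l'}" using private_nbr[OF z w zw] .
  have yb: "y \<notin> nbrs b" using y Ibw by blast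
  have xb: "x \<notin> nbrs b" using x Ibz by blast
  have xw: "x \<notin> nbrs w" using x Iwz by blast
  have "indep {b}" using indep_insert_private[OF indep_empty lb] by simp
  then have "indep {w, b}"
    using y(1) yb by - (rule indep_insert_private[of _ y], auto)
  then have "indep {z, w, b}"
    using x(1) xb xw by - (rule indep_insert_private[of _ x], auto)
  then have "indep {l, z, w, b}"
    using twin_nbrs_independent[OF w b] twin_nbrs_independent[OF z b] b
    by - (rule indep_insert_private[of _ b], auto)
  moreover have "{l, z, w, b} \<subseteq> covered {l, z, w, b}" using b w z lb by simp
  moreover have "card (covered {l, z, w, b}) \<le> card {l, z, w, b} * d"
  proof -
    have F: "card {l, l'} = 2" using l(2) by simp
    have 1: "card (nbrs w \<union> nbrs b) + card {l, l'} \<le> d + 1 + card (nbrs b)"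
      using twin_common b w by (intro card_Un_nbrs_le) auto
    have 2: "card (nbrs z \<union> (nbrs w \<union> nbrs b)) + card {l, l'} \<le> d + 1 + card (nbrs w \<union> nbrs b)"
      using twin_common[OF w] twin_common[OF z] by (intro card_Un_nbrs_le) auto
    have 3: "card (nbrs l \<union> (nbrs z \<union> (nbrs w \<union> nbrs b)))
        \<le> card (nbrs l) + card (nbrs z \<union> (nbrs w \<union> nbrs b))"
      by (rule card_Un_le)
    show ?thesis
      using 1 2 3 F card_nbrs_le[of l] card_nbrs_le[of b] distinct by simp
  qed
  ultimately show False using no_seed[of "{l, z, w, b}"] by (simp add: seed_def)
qed

text \<open>
  The path \<open>x\<close>, \<open>b\<close>, \<open>l\<close>, \<open>w\<close> for a neighbour \<open>x\<close> of \<open>b\<close> other than \<open>l\<close> and \<open>l'\<close>: it is induced, hence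
  independent. The neighbourhoods of \<open>x\<close> and \<open>l\<close> share \<open>b\<close> and \<open>b'\<close>, and those of \<open>b\<close> and \<open>w\<close> share
  \<open>l\<close> and \<open>l'\<close>, so the path covers at most \<open>4 (d + 1) - 4\<close> vertices.
\<close>
lemma no_twin_in_two_classes:
  assumes b: "b \<in> nbrs l" and b': "b \<noteq> b'" "proportional b b'"
    and w: "w \<in> nbrs l" and bw: "\<not> proportional b w"
  shows False
proof -
  have lb: "l \<in> nbrs b" and lw: "l \<in> nbrs w" using b w nbrs_sym by blast+
  obtain x where x: "x \<in> nbrs b" "x \<notin> {l, l'}" using private_nbr[OF b w bw] .
  have xw: "x \<notin> nbrs w" using x twin_nbrs_nonproportional(1)[OF b w bw] by blast
  have xl: "x \<notin> nbrs l" using x(1) twin_nbrs_independent[OF b] by blast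
  have bx: "b \<in> nbrs x" "b' \<in> nbrs x" using x(1) proportional_nbrs[OF b'(2)] nbrs_sym by auto
  have b'l: "b' \<in> nbrs l" using lb proportional_nbrs[OF b'(2)] nbrs_sym by auto
  have distinct: "b \<noteq> w" "l \<noteq> b" "l \<noteq> w" "x \<noteq> l" "x \<noteq> b" "x \<noteq> w"
    using bw b w x xl proportional_refl by auto
  \<comment> \<open>In the order \<open>x\<close>, \<open>l\<close>, \<open>w\<close>, \<open>b\<close>, the columns have private rows \<open>b\<close>, \<open>w\<close>, \<open>l\<close>, \<open>x\<close>.\<close>
  have "indep {x}" using indep_insert_private[OF indep_empty bx(1)] by simp
  then have "indep {l, x}"
    using w xw nbrs_sym[of w x] by - (rule indep_insert_private[of _ w], auto)
  then have "indep {w, l, x}"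
    using lw xl nbrs_sym[of l x] by - (rule indep_insert_private[of _ l], auto)
  then have "indep {b, w, l, x}"
    using x(1) xl xw by - (rule indep_insert_private[of _ x], auto)
  moreover have "{b, w, l, x} \<subseteq> covered {b, w, l, x}" using b w lb x(1) by simp
  moreover have "card (covered {b, w, l, x}) \<le> card {b, w, l, x} * d"
  proof -
    have F: "card {l, l'} = 2" "card {b, b'} = 2" using l(2) b'(1) by simp_all
    have 1: "card (nbrs x \<union> nbrs l) + card {b, b'} \<le> d + 1 + card (nbrs l)"
      using bx b b'l by (intro card_Un_nbrs_le) auto
    have 2: "card (nbrs w \<union> (nbrs x \<union> nbrs l)) \<le> card (nbrs w) + card (nbrs x \<union> nbrs l)"
      by (rule card_Un_le)
    have 3: "card (nbrs b \<union> (nbrs w \<union> (nbrs x \<union> nbrs l))) + card {l, l'}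
        \<le> d + 1 + card (nbrs w \<union> (nbrs x \<union> nbrs l))"
      using twin_common[OF w] twin_common[OF b] by (intro card_Un_nbrs_le) auto
    show ?thesis
      using 1 2 3 F card_nbrs_le[of l] card_nbrs_le[of w] distinct
      by (simp add: Un_commute Un_left_commute)
  qed
  ultimately show False using no_seed[of "{b, w, l, x}"] by (simp add: seed_def)
qed

text \<open>
  If two neighbours of \<open>l\<close> are not proportional, then \<open>l\<close> has \<open>d + 1 \<ge> 3\<close> neighbours. A third
  one either lies in a class of its own or is proportional to one of the two; both cases are
  excluded.
\<close>
lemma twin_nbrs_proportional:
  assumes b: "b \<in> nbrs l" and w: "w \<in> nbrs l"
  shows "proportional b w"
proof (rule ccontr)
  assume bw: "\<not> proportional b w"
  then have wb: "\<not> proportional w b" using proportional_sym by blast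
  have "card {b, w} < card (nbrs l)"
    using twin_nbrs_nonproportional(2)[OF b w bw] d_ge_2 by (cases "b = w") simp_all
  then have "\<not> nbrs l \<subseteq> {b, w}" by (meson card_mono finite.emptyI finite.insertI not_le)
  then obtain z where z: "z \<in> nbrs l" "z \<noteq> b" "z \<noteq> w" by blast
  show False
    using no_three_classes[OF b w z(1) bw] no_twin_in_two_classes[OF b _ _ w bw, of z]
      no_twin_in_two_classes[OF w _ _ b wb, of z] z by blast
qed

text \<open>
  Let \<open>b\<close> be a neighbour of \<open>l\<close>. All neighbours of \<open>l\<close> have the same neighbourhood \<open>nbrs b\<close>. If some
  \<open>c\<close> in it were not proportional to \<open>l\<close>, then \<open>nbrs l \<subseteq> nbrs c\<close>, so that the path \<open>c\<close>, \<open>b\<close>, \<open>l\<close> covers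
  only \<open>2 (d + 1) \<le> 3 d\<close> vertices. Hence \<open>nbrs b\<close> and \<open>nbrs l\<close> are completely joined with no edge leaving
  their union, which by connectivity is everything.
\<close>
lemma twin_rank_one_bipartition: "\<exists>A B. rank_one_bipartition A B"
proof -
  obtain b where b: "b \<in> nbrs l" using nbrs_nonempty[OF l(1)] by blast
  have lb: "l \<in> nbrs b" using b nbrs_sym by blast
  have nb: "nbrs b' = nbrs b" if "b' \<in> nbrs l" for b'
    using proportional_nbrs twin_nbrs_proportional[OF that b] by blast
  have prop_l: "proportional c l" if c: "c \<in> nbrs b" for c
  proof (rule ccontr)
    assume np: "\<not> proportional c l"
    have sub: "nbrs l \<subseteq> nbrs c" using nb c nbrs_sym by blast
    have cl: "c \<notin> nbrs l" using c twin_nbrs_independent[OF b] by blast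
    have bc: "b \<in> nbrs c" using c nbrs_sym by blast
    have distinct: "c \<noteq> l" "b \<noteq> c" "b \<noteq> l" using np proportional_refl b c by auto
    have "indep {c, l}" using np b bc by (intro indep_nonproportional) auto
    then have "indep {b, c, l}"
      using lb cl nbrs_sym[of l c] by - (rule indep_insert_private[of _ l], auto)
    moreover have "{b, c, l} \<subseteq> covered {b, c, l}" using b c lb by simp
    moreover have "card (covered {b, c, l}) \<le> card {b, c, l} * d"
    proof -
      have "covered {b, c, l} = nbrs b \<union> nbrs c" using sub by auto
      moreover have "card (nbrs b \<union> nbrs c) \<le> card (nbrs b) + card (nbrs c)" by (rule card_Un_le)
      ultimately show ?thesis
        using card_nbrs_le[of b] card_nbrs_le[of c] d_ge_2 distinct by simp
    qed
    ultimately show False using no_seed[of "{b, c, l}"] by (simp add: seed_def)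
  qed
  have nl: "nbrs a = nbrs l" if "a \<in> nbrs b" for a
    using proportional_nbrs[OF prop_l[OF that]] .
  have "nbrs b \<inter> nbrs l = {}" using twin_nbrs_independent[OF b] by blast
  moreover have "nbrs b \<union> nbrs l = V"
  proof (rule ccontr)
    assume "nbrs b \<union> nbrs l \<noteq> V"
    then obtain p u where "p \<in> nbrs b \<union> nbrs l" "u \<in> V - (nbrs b \<union> nbrs l)" "M p u \<noteq> 0"
      using connected[of "nbrs b \<union> nbrs l"] nbrs_subset lb by blast
    then have "p \<in> nbrs b \<or> p \<in> nbrs l" "u \<in> nbrs p" "u \<notin> nbrs b" "u \<notin> nbrs l"
      by (simp_all add: in_nbrs)
    then show False using nl[of p] nb[of p] by blast
  qed
  moreover have "proportional a a'" if "a \<in> nbrs b" "a' \<in> nbrs b" for a a'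
    using prop_l that proportional_sym proportional_trans by blast
  ultimately have "rank_one_bipartition (nbrs b) (nbrs l)"
    unfolding rank_one_bipartition_def using nl nb twin_nbrs_proportional by blast
  then show ?thesis by blast
qed

end

text \<open>
  The bound can fail only for a rank-one bipartition. There the two ends of an edge
  already form an independent set, so failure forces more than \<open>2 d\<close> vertices.
\<close>
theorem indep_bound_or_bipartition:
  obtains S where "indep S" "card V \<le> card S * d"
  | A B where "rank_one_bipartition A B" "card V > 2 * d"
proof (cases "\<exists>S. seed S")
  case True
  then show thesis using seed_extends that(1) by blast
next
  case False
  show thesis
  proof (cases "\<exists>l l'. l \<in> V \<and> l \<noteq> l' \<and> proportional l l'")
    case True
    then obtain A B where AB: "rank_one_bipartition A B"
      using twin_rank_one_bipartition False by blast
    show thesis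
    proof (cases "card V \<le> 2 * d")
      case True
      obtain u where "u \<in> V" using card_V by fastforce
      then obtain w where w: "w \<in> nbrs u" using nbrs_nonempty by blast
      then have "card {u, w} = 2" by (cases "u = w") simp_all
      then show thesis using that(1)[OF indep_edge[OF w]] True by simp
    qed (use AB that(2) in auto)
  next
    case no_twins: False
    obtain S where S: "indep S" "2 * card V \<le> card S * (d + 1 + 1)"
      using twin_free_bound[of "d + 1"] nbrs_nonempty card_nbrs_le no_twins by metis
    have "card S * (d + 1 + 1) \<le> card S * (2 * d)" using d_ge_2 by (intro mult_left_mono) simp_all
    then have "card V \<le> card S * d" using S(2) by linarith
    then show thesis using S(1) that(1) by blast
  qed
qed

end

section \<open>Gain graphs as Hermitian weightings\<close>

lemma inverse_eq_cnj:
  assumes "norm (z::complex) = 1"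
  shows "inverse z = cnj z"
proof (rule inverse_unique)
  show "z * cnj z = 1" using assms by (simp add: complex_norm_square[symmetric])
qed

context unit_gain_graph
begin

definition weight :: "'a \<Rightarrow> 'a \<Rightarrow> complex" where
  "weight u w = (if (u, w) \<in> parcs G then \<phi> (u, w) else 0)"

lemma gain_nonzero: "(u, w) \<in> parcs G \<Longrightarrow> \<phi> (u, w) \<noteq> 0"
  using gain_unit by fastforce

lemma arc_sym: "(u, w) \<in> parcs G \<longleftrightarrow> (w, u) \<in> parcs G"
  using graph_symmetric by auto

lemma weight_nonzero: "weight u w \<noteq> 0 \<longleftrightarrow> (u, w) \<in> parcs G"
  by (simp add: weight_def gain_nonzero)

sublocale W: hermitian_weighting "pverts G" weight
proof
  show "finite (pverts G)" by (rule pair_finite_verts)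
  show "u \<in> pverts G \<and> w \<in> pverts G" if "weight u w \<noteq> 0" for u w
    using that wellformed' unfolding weight_nonzero by blast
  show "weight w u = cnj (weight u w)" for u w
  proof (cases "(u, w) \<in> parcs G")
    case True
    then have wu: "(w, u) \<in> parcs G" using arc_sym by blast
    have "\<phi> (w, u) = inverse (\<phi> (u, w))" by (rule gain_inverse[OF wu])
    also have "\<dots> = cnj (\<phi> (u, w))" by (rule inverse_eq_cnj[OF gain_unit[OF True]])
    finally show ?thesis using True wu by (simp add: weight_def)
  next
    case False
    then show ?thesis using arc_sym[of u w] by (simp add: weight_def)
  qed
  show "weight u u = 0" for u
    using pair_no_loops[of "(u, u)"] by (auto simp: weight_def)
qed

lemma nbrs_eq: "W.nbrs u = {w. (u, w) \<in> parcs G}"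
  by (simp add: W.nbrs_def weight_nonzero)

lemma out_degree_eq: "out_degree (with_proj G) u = card (W.nbrs u)"
proof -
  have "out_arcs (with_proj G) u = Pair u ` W.nbrs u" by (auto simp: out_arcs_def nbrs_eq)
  then show ?thesis by (simp add: out_degree_def card_image inj_on_def)
qed

lemma card_nbrs_le_max_degree: "card (W.nbrs u) \<le> max_degree G"
proof (cases "u \<in> pverts G")
  case True
  then show ?thesis
    unfolding max_degree_def out_degree_eq[symmetric] using pair_finite_verts by (intro Max_ge) auto
next
  case False
  then have "W.nbrs u = {}" using W.in_nbrs_V by blast
  then show ?thesis by simp
qed

lemma max_degree_attained:
  assumes "pverts G \<noteq> {}"
  obtains u where "u \<in> pverts G" "card (W.nbrs u) = max_degree G"
proof -
  have "max_degree G \<in> out_degree (with_proj G) ` pverts G"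
    unfolding max_degree_def using assms pair_finite_verts by (intro Max_in) auto
  then show thesis using that by (auto simp: out_degree_eq)
qed

lemma connected_weighting:
  assumes conn: "Digraph_Component.connected (with_proj G)" and deg: "max_degree G \<ge> 3"
  shows "connected_weighting (pverts G) weight (max_degree G - 1)"
proof
  have sc: "strongly_connected (with_proj G)"
    using symmetric_connected_imp_strongly_connected[OF pair_sym_arcs conn] .
  then have ne: "pverts G \<noteq> {}" by (auto simp: strongly_connected_def)
  show "card (W.nbrs u) \<le> max_degree G - 1 + 1" for u
    using card_nbrs_le_max_degree[of u] deg by simp
  show "2 \<le> max_degree G - 1" using deg by simp
  obtain u where "u \<in> pverts G" "card (W.nbrs u) = max_degree G" using max_degree_attained[OF ne] .
  then show "2 \<le> card (pverts G)"
    using card_mono[OF pair_finite_verts W.nbrs_subset, of u] deg by simp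
  fix P assume P: "P \<subseteq> pverts G" "P \<noteq> {}" "P \<noteq> pverts G"
  show "\<exists>p\<in>P. \<exists>u\<in>pverts G - P. weight p u \<noteq> 0"
  proof (rule ccontr)
    assume closed: "\<not> ?thesis"
    obtain p q where pq: "p \<in> P" "q \<in> pverts G - P" using P by blast
    have "p \<rightarrow>\<^sup>*\<^bsub>with_proj G\<^esub> q" using sc pq P(1) by (auto simp: strongly_connected_def)
    then have "q \<in> P"
    proof (induction rule: reachable_induct)
      case base
      show ?case by (rule pq(1))
    next
      case (step x y)
      then have "(x, y) \<in> parcs G" by simp
      then show ?case using closed step.IH wellformed' weight_nonzero by blast
    qed
    then show False using pq(2) by blast
  qed
qed

context
  fixes n :: nat and v :: "nat \<Rightarrow> 'a"
  assumes v: "bij_betw v {0..<n} (pverts G)"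
begin

text \<open>
  Independence in the weighting quantifies over rows at all elements of the type, but rows outside
  the vertex set are zero, so both notions impose the same equations.
\<close>
lemma indep_columns_iff:
  assumes I: "I \<subseteq> {..<n}"
  shows "indep_columns (gain_adjacency_matrix n v G \<phi>) I \<longleftrightarrow> W.indep (v ` I)"
proof -
  let ?A = "gain_adjacency_matrix n v G \<phi>"
  have inj: "inj_on v I" using v I by (auto simp: bij_betw_def atLeast0LessThan intro: inj_on_subset)
  have V: "pverts G = v ` {..<n}" using v by (simp add: bij_betw_def atLeast0LessThan)
  have entry: "?A $$ (s, t) = weight (v s) (v t)" if "s < n" "t < n" for s t
    using that by (simp add: gain_adjacency_matrix_def weight_def)
  have dim: "dim_row ?A = n" by (simp add: gain_adjacency_matrix_def)
  have row: "(\<Sum>i\<in>I. ?A $$ (s, i) * c (v i)) = (\<Sum>u\<in>v ` I. weight (v s) u * c u)" if "s < n" for s c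
    using that I entry by (subst sum.reindex[OF inj]) (auto intro!: sum.cong)
  have outside: "(\<Sum>u\<in>v ` I. weight t u * c u) = 0" if "t \<notin> pverts G" for t c
    using that W.support by (intro sum.neutral) auto
  have sums: "(\<forall>t. (\<Sum>u\<in>v ` I. weight t u * c u) = 0)
      \<longleftrightarrow> (\<forall>s<n. (\<Sum>i\<in>I. ?A $$ (s, i) * c (v i)) = 0)" (is "?lhs \<longleftrightarrow> ?rhs") for c
  proof
    assume ?lhs
    then show ?rhs using row[of _ c] by metis
  next
    assume ?rhs
    then have inside: "(\<Sum>u\<in>v ` I. weight (v s) u * c u) = 0" if "s < n" for s
      using that row[of s c] by simp
    show ?lhs
    proof
      fix t
      show "(\<Sum>u\<in>v ` I. weight t u * c u) = 0"
      proof (cases "t \<in> pverts G")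
        case True
        then obtain s where "s < n" "t = v s" using V by blast
        then show ?thesis using inside by simp
      qed (rule outside)
    qed
  qed
  show ?thesis
  proof
    assume A: "indep_columns ?A I"
    have "\<forall>u\<in>v ` I. c u = 0" if "\<forall>t. (\<Sum>u\<in>v ` I. weight t u * c u) = 0" for c
    proof -
      have "\<forall>s<dim_row ?A. (\<Sum>i\<in>I. ?A $$ (s, i) * c (v i)) = 0" using that sums dim by simp
      then have "\<forall>i\<in>I. c (v i) = 0"
        using A[unfolded indep_columns_def, rule_format, of "\<lambda>i. c (v i)"] by blast
      then show ?thesis by blast
    qed
    moreover have "v ` I \<subseteq> pverts G" using V I by blast
    ultimately show "W.indep (v ` I)" unfolding W.indep_def by blast
  next
    assume W: "W.indep (v ` I)"
    have "\<forall>i\<in>I. c i = 0" if c: "\<forall>s<dim_row ?A. (\<Sum>i\<in>I. ?A $$ (s, i) * c i) = 0" for c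
    proof -
      define c' where "c' u = c (the_inv_into I v u)" for u
      have c': "c' (v i) = c i" if "i \<in> I" for i
        using that by (simp add: c'_def the_inv_into_f_f[OF inj])
      have "\<forall>s<n. (\<Sum>i\<in>I. ?A $$ (s, i) * c' (v i)) = 0" using c dim by (simp add: c')
      then have "\<forall>u\<in>v ` I. c' u = 0" using W sums unfolding W.indep_def by blast
      then show ?thesis using c' by simp
    qed
    then show "indep_columns ?A I" unfolding indep_columns_def by blast
  qed
qed

lemma card_indep_le_rank:
  assumes "W.indep S"
  shows "card S \<le> vec_space.rank n (gain_adjacency_matrix n v G \<phi>)"
proof -
  have "S \<subseteq> v ` {..<n}"
    using W.indep_subset_V[OF assms] v by (simp add: bij_betw_def atLeast0LessThan)
  then obtain I where I: "I \<subseteq> {..<n}" "inj_on v I" "S = v ` I"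
    unfolding subset_image_inj by metis
  have "card I \<le> vec_space.rank n (gain_adjacency_matrix n v G \<phi>)"
    using indep_columns_iff[OF I(1)] assms I
    by (intro vec_space.card_indep_columns_le_rank[of _ n n I])
      (auto simp: gain_adjacency_matrix_def)
  then show ?thesis using I by (simp add: card_image)
qed

lemma rank_attained_by_indep:
  obtains S where "W.indep S" "card S = vec_space.rank n (gain_adjacency_matrix n v G \<phi>)"
proof -
  let ?A = "gain_adjacency_matrix n v G \<phi>"
  have "?A \<in> carrier_mat n n" by (simp add: gain_adjacency_matrix_def)
  then obtain I where I: "I \<subseteq> {..<n}" "indep_columns ?A I" "card I = vec_space.rank n ?A"
    using vec_space.rank_attained_by_indep_columns by blast
  have "inj_on v I"
    using v I(1) by (auto simp: bij_betw_def atLeast0LessThan intro: inj_on_subset)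
  then show thesis
    using that[of "v ` I"] I indep_columns_iff[OF I(1)] by (simp add: card_image)
qed

end

text \<open>
  The off-diagonal block has rank one, so \<open>\<phi>(b, a) \<phi>(b0, a0) = \<phi>(b0, a) \<phi>(b, a0)\<close> for fixed \<open>a0\<close>
  and \<open>b0\<close>. Solved for \<open>\<phi>(b, a)\<close>, this is a product of a function of \<open>b\<close> and a function of \<open>a\<close>,
  which together form the switching function.
\<close>
lemma bipartition_imp_switching:
  assumes bip: "W.rank_one_bipartition A B" and ne: "A \<noteq> {}" "B \<noteq> {}"
  shows "switching_equivalent_complete_bipartite (card A) (card B) G \<phi>"
proof -
  obtain a0 b0 where a0: "a0 \<in> A" and b0: "b0 \<in> B" using ne by blast
  have AB: "A \<inter> B = {}" "A \<union> B = pverts G" and nA: "\<And>a. a \<in> A \<Longrightarrow> W.nbrs a = B"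
    and nB: "\<And>b. b \<in> B \<Longrightarrow> W.nbrs b = A"
    and rank1: "\<And>a. a \<in> A \<Longrightarrow> W.proportional a a0"
    using bip a0 unfolding W.rank_one_bipartition_def by blast+
  have ab: "(a, b) \<in> parcs G" and ba: "(b, a) \<in> parcs G" if "a \<in> A" "b \<in> B" for a b
    using that nA[of a] nB[of b] by (auto simp: nbrs_eq)
  have arcs: "parcs G = A \<times> B \<union> B \<times> A"
  proof
    show "parcs G \<subseteq> A \<times> B \<union> B \<times> A"
    proof
      fix e assume e: "e \<in> parcs G"
      obtain x y where xy: "e = (x, y)" by (cases e)
      then have "y \<in> W.nbrs x" "x \<in> A \<union> B"
        using e wellformed' AB(2) by (auto simp: nbrs_eq)
      then show "e \<in> A \<times> B \<union> B \<times> A" using nA[of x] nB[of x] xy by blast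
    qed
  qed (use ab ba in blast)
  have "complete_bipartite_digraph (card A) (card B) (with_proj G)"
    unfolding complete_bipartite_digraph_pair_def using AB arcs pair_finite_verts by blast
  moreover have "switching_equivalent G \<phi> (\<lambda>_. 1)"
  proof -
    define \<zeta> where "\<zeta> x = (if x \<in> A then \<phi> (b0, x) else \<phi> (b0, a0) * inverse (\<phi> (x, a0)))" for x
    have \<zeta>A: "\<zeta> a = \<phi> (b0, a)" if "a \<in> A" for a using that by (simp add: \<zeta>_def)
    have \<zeta>B: "\<zeta> b = \<phi> (b0, a0) * inverse (\<phi> (b, a0))" if "b \<in> B" for b
      using that AB(1) by (auto simp: \<zeta>_def)
    have unit: "norm (\<phi> (b, a)) = 1" if "a \<in> A" "b \<in> B" for a b
      using gain_unit[OF ba[OF that]] .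
    have nz: "\<phi> (b, a) \<noteq> 0" if "a \<in> A" "b \<in> B" for a b
      using gain_nonzero[OF ba[OF that]] .
    have norm: "norm (\<zeta> x) = 1" if "x \<in> pverts G" for x
    proof (cases "x \<in> A")
      case True
      then show ?thesis using unit b0 by (simp add: \<zeta>A)
    next
      case False
      then have "x \<in> B" using that AB(2) by blast
      then show ?thesis using unit a0 b0 by (simp add: \<zeta>B norm_mult norm_inverse)
    qed
    have BA: "\<phi> (b, a) = inverse (\<zeta> b) * \<zeta> a" if a: "a \<in> A" and b: "b \<in> B" for a b
    proof -
      obtain k where k: "\<forall>t. weight t a = k * weight t a0"
        using rank1[OF a] by (auto simp: W.proportional_def)
      have "\<phi> (b, a) = k * \<phi> (b, a0)" "\<phi> (b0, a) = k * \<phi> (b0, a0)"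
        using k[rule_format, of b] k[rule_format, of b0] ba a b a0 b0 by (simp_all add: weight_def)
      then show ?thesis
        using nz[OF a0 b0] nz[OF a0 b] by (simp add: \<zeta>A[OF a] \<zeta>B[OF b] field_simps)
    qed
    have "\<phi> (a, b) = inverse (\<zeta> a) * \<zeta> b" if a: "a \<in> A" and b: "b \<in> B" for a b
      using gain_inverse[OF ab[OF a b]] BA[OF a b] by (simp add: mult.commute)
    then have "\<forall>(u, w)\<in>parcs G. \<phi> (u, w) = inverse (\<zeta> u) * 1 * \<zeta> w"
      using BA arcs by auto
    then show ?thesis unfolding switching_equivalent_def using norm by blast
  qed
  ultimately show ?thesis by (simp add: switching_equivalent_complete_bipartite_def)
qed

text \<open>
  If all gains are \<open>\<phi>(t, x) = \<zeta>(x) / \<zeta>(t)\<close>, two vertices \<open>x\<close> and \<open>y\<close> with equal neighbourhoods have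
  proportional columns with factor \<open>\<zeta>(x) / \<zeta>(y)\<close>.
\<close>
lemma switching_imp_bipartition:
  assumes "switching_equivalent_complete_bipartite p q G \<phi>"
  obtains A B where "W.rank_one_bipartition A B" "card A = p" "card B = q"
proof -
  obtain A B where AB: "pverts G = A \<union> B" "A \<inter> B = {}" "card A = p" "card B = q"
    and arcs: "parcs G = A \<times> B \<union> B \<times> A"
    using assms
    unfolding switching_equivalent_complete_bipartite_def complete_bipartite_digraph_pair_def
    by blast
  obtain \<zeta> where \<zeta>: "\<forall>u\<in>pverts G. norm (\<zeta> u) = 1"
    and sw: "\<forall>(u, w)\<in>parcs G. \<phi> (u, w) = inverse (\<zeta> u) * 1 * \<zeta> w"
    using assms unfolding switching_equivalent_complete_bipartite_def switching_equivalent_def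
    by blast
  have nz: "\<zeta> u \<noteq> 0" if "u \<in> pverts G" for u
    using \<zeta> that by fastforce
  have rank1: "W.proportional x y"
    if xy: "x \<in> pverts G" "y \<in> pverts G" and same: "W.nbrs x = W.nbrs y" for x y
  proof -
    have "weight t x = \<zeta> x / \<zeta> y * weight t y" for t
    proof (cases "(t, x) \<in> parcs G")
      case True
      then have ty: "(t, y) \<in> parcs G" using same arc_sym by (auto simp: nbrs_eq)
      have "\<phi> (t, x) = inverse (\<zeta> t) * \<zeta> x" "\<phi> (t, y) = inverse (\<zeta> t) * \<zeta> y"
        using sw True ty by auto
      then show ?thesis using True ty nz[OF xy(2)] by (simp add: weight_def)
    next
      case False
      then have "(t, y) \<notin> parcs G" using same arc_sym by (auto simp: nbrs_eq)
      then show ?thesis using False by (simp add: weight_def)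
    qed
    moreover have "\<zeta> x / \<zeta> y \<noteq> 0" using nz xy by simp
    ultimately show ?thesis unfolding W.proportional_def by blast
  qed
  have nA: "\<forall>a\<in>A. W.nbrs a = B" and nB: "\<forall>b\<in>B. W.nbrs b = A"
    using arcs AB(2) by (auto simp: nbrs_eq)
  then have "W.rank_one_bipartition A B"
    unfolding W.rank_one_bipartition_def using AB(1,2) rank1 by simp
  then show thesis using that AB by blast
qed

lemma bipartition_max_degree:
  assumes bip: "W.rank_one_bipartition A B" and "pverts G \<noteq> {}"
  shows "max_degree G \<le> max (card A) (card B)"
proof -
  obtain u where u: "u \<in> pverts G" "card (W.nbrs u) = max_degree G"
    using max_degree_attained[OF assms(2)] .
  then have "W.nbrs u = A \<or> W.nbrs u = B"
    using bip unfolding W.rank_one_bipartition_def by blast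
  then show ?thesis using u(2) by auto
qed

end

theorem theorem4p2:
  fixes G :: "'a pair_pre_digraph" and \<phi> :: "'a \<times> 'a \<Rightarrow> complex"
    and n :: nat and v :: "nat \<Rightarrow> 'a"
  assumes "unit_gain_graph G \<phi>"
    and "Digraph_Component.connected (with_proj G)"
    and "bij_betw v {0..<n} (pverts G)"
    and "max_degree G \<ge> 3"
  shows "real (vec_space.rank n (gain_adjacency_matrix n v G \<phi>)) \<ge> real n / (real (max_degree G) - 1)
    \<longleftrightarrow> (even n \<longrightarrow> \<not> switching_equivalent_complete_bipartite (n div 2) (n div 2) G \<phi>) \<and>
        (odd n \<longrightarrow> \<not> switching_equivalent_complete_bipartite ((n + 1) div 2) ((n - 1) div 2) G \<phi>)"
proof -
  interpret unit_gain_graph G \<phi> by fact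
  define d where "d = max_degree G - 1"
  define r where "r = vec_space.rank n (gain_adjacency_matrix n v G \<phi>)"
  interpret C: connected_weighting "pverts G" weight d
    unfolding d_def by (rule connected_weighting[OF assms(2,4)])
  have d: "d \<ge> 2" "max_degree G = d + 1" using assms(4) by (simp_all add: d_def)
  have n: "card (pverts G) = n" using bij_betw_same_card[OF assms(3)] by simp
  have ne: "pverts G \<noteq> {}" using C.card_V by auto
  \<comment> \<open>Rounding up and down merges the even and the odd case.\<close>
  define exceptional where "exceptional \<longleftrightarrow>
    switching_equivalent_complete_bipartite ((n + 1) div 2) (n div 2) G \<phi>"
  have "real n / (real (max_degree G) - 1) \<le> real r \<longleftrightarrow> real n \<le> real (r * d)"
    using d by (simp add: divide_le_eq)
  then have lhs: "real n / (real (max_degree G) - 1) \<le> real r \<longleftrightarrow> n \<le> r * d"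
    by (simp only: of_nat_le_iff)
  have rhs: "(even n \<longrightarrow> \<not> switching_equivalent_complete_bipartite (n div 2) (n div 2) G \<phi>) \<and>
        (odd n \<longrightarrow> \<not> switching_equivalent_complete_bipartite ((n + 1) div 2) ((n - 1) div 2) G \<phi>)
     \<longleftrightarrow> \<not> exceptional"
    unfolding exceptional_def by (cases "even n") (auto elim!: evenE oddE)
  have "n \<le> r * d \<longleftrightarrow> \<not> exceptional"
  proof
    assume le: "n \<le> r * d"
    show "\<not> exceptional"
    proof
      assume exceptional
      then obtain A B where AB: "W.rank_one_bipartition A B" "card A = (n + 1) div 2" "card B = n div 2"
        unfolding exceptional_def by (rule switching_imp_bipartition)
      have "max_degree G \<le> (n + 1) div 2"
        using bipartition_max_degree[OF AB(1) ne] AB(2,3) by simp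
      then have "2 * d < n" using d by linarith
      moreover have "r \<le> 2"
        using rank_attained_by_indep[OF assms(3)] W.indep_card_le_2[OF AB(1)] unfolding r_def by metis
      then have "r * d \<le> 2 * d" by simp
      ultimately show False using le by linarith
    qed
  next
    assume ok: "\<not> exceptional"
    show "n \<le> r * d"
    proof (rule C.indep_bound_or_bipartition)
      fix S assume S: "W.indep S" "card (pverts G) \<le> card S * d"
      have "card S * d \<le> r * d"
        using card_indep_le_rank[OF assms(3) S(1)] unfolding r_def by (rule mult_right_mono) simp
      then show ?thesis using S(2) n by linarith
    next
      fix A B assume AB: "W.rank_one_bipartition A B" "card (pverts G) > 2 * d"
      \<comment> \<open>Either part may be the larger one, so both orders of the bipartition are needed.\<close>
      have BA: "W.rank_one_bipartition B A"
        using AB(1) unfolding W.rank_one_bipartition_def by blast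
      have V: "A \<inter> B = {}" "A \<union> B = pverts G" and nA: "\<And>a. a \<in> A \<Longrightarrow> W.nbrs a = B"
        and nB: "\<And>b. b \<in> B \<Longrightarrow> W.nbrs b = A"
        using AB(1) unfolding W.rank_one_bipartition_def by blast+
      obtain u where u: "u \<in> pverts G" using ne by blast
      then have "W.nbrs u \<noteq> {}" by (rule C.nbrs_nonempty)
      then obtain a b where ab: "a \<in> A" "b \<in> B" using u V(2) nA[of u] nB[of u] by blast
      have le: "card A \<le> d + 1" "card B \<le> d + 1"
        using C.card_nbrs_le[of a] C.card_nbrs_le[of b] nA[OF ab(1)] nB[OF ab(2)] by simp_all
      have "finite A" "finite B" using V(2) pair_finite_verts by (metis finite_Un)+
      then have sum: "card A + card B = n" using card_Un_disjoint[of A B] V n by simp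
      have swAB: "switching_equivalent_complete_bipartite (card A) (card B) G \<phi>"
        using bipartition_imp_switching[OF AB(1)] ab by blast
      have swBA: "switching_equivalent_complete_bipartite (card B) (card A) G \<phi>"
        using bipartition_imp_switching[OF BA] ab by blast
      have "(card A = (n + 1) div 2 \<and> card B = n div 2) \<or> (card B = (n + 1) div 2 \<and> card A = n div 2)"
      proof -
        have "n = 2 * d + 1 \<or> n = 2 * d + 2" using le sum AB(2) n by linarith
        then show ?thesis
        proof
          assume eq: "n = 2 * d + 1"
          then have "card A = d + 1 \<and> card B = d \<or> card B = d + 1 \<and> card A = d"
            using le sum by linarith
          then show ?thesis using eq by auto
        next
          assume eq: "n = 2 * d + 2"
          then have "card A = d + 1 \<and> card B = d + 1" using le sum by linarith
          then show ?thesis using eq by auto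
        qed
      qed
      then have exceptional unfolding exceptional_def using swAB swBA by metis
      then show ?thesis using ok by blast
    qed
  qed
  then show ?thesis using lhs rhs unfolding r_def by blast
qed

end
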